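(* For any $t\in\mathbb{C}$, the map $\Phi_t:\mathcal{B}_t[\xi,z]\to\mathcal{A}[\xi,z]$ is an isomorphism of $\mathbb{C}$-algebras. Therefore, in the sense of deformation theory, the deformation $\mathcal{B}_t[\xi,z]$ is a trivial deformation of the commutative polynomial algebra $\mathcal{A}[\xi,z]$.
   Context: Let $\xi=(\xi_1,\dots,\xi_n)$ and $z=(z_1,\dots,z_n)$ be $2n$ commuting free variables, $\partial_i=\partial/\partial z_i$, $\delta_i=\partial/\partial \xi_i$. $\mathcal{A}[\xi,z]$ is the vector space $\mathbb{C}[\xi,z]$ with the usual polynomial multiplication. For $t\in\mathbb{C}$, $\mathcal{B}_t[\xi,z]$ is the vector space $\mathbb{C}[\xi,z]$ with the product $f\ast_t g:=\mu\big(e^{-t\Omega}(f\otimes g)\big)$, where $\Omega=\sum_{i=1}^n(\partial_i\otimes\delta_i+\delta_i\otimes\partial_i)$ and $\mu(f\otimes g)=fg$ is the usual multiplication; so $\mathcal{B}_0[\xi,z]=\mathcal{A}[\xi,z]$. Let $\Lambda:=\sum_{i=1}^n\delta_i\partial_i$ (locally nilpotent) and $\Phi_t:=e^{t\Lambda}=\sum_{m\ge0}\frac{t^m\Lambda^m}{m!}$, a linear bijection of $\mathbb{C}[\xi,z]$ with inverse $\Phi_{-t}$. A deformation $\ast_t$ of a product (viewing $t$ as a formal parameter) is trivial if there is a family of linear maps $\Psi_t=\mathrm{id}+t\psi_1+t^2\psi_2+\cdots$ of the underlying vector space with $\Psi_t(f\ast_t g)=\Psi_t(f)\Psi_t(g)$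 for all $f,g$. *)

theory Defs
  imports
    "HOL-Library.Poly_Mapping"
    "HOL-Library.Groups_Big_Fun"
    "HOL-Algebra.QuotRing"
    "HOL-Algebra.Module"
    "HOL-Algebra.Algebraic_Closure_Type"
begin

section \<open>The polynomial space and its tensor square\<close>

text \<open>
  \<open>'a \<Rightarrow>\<^sub>0 complex\<close> is the complex vector space with basis \<open>'a\<close>.  The \<open>2n\<close> variables are indexed
  by \<open>'n + 'n\<close> with \<open>n = CARD('n)\<close>: \<open>Inl i\<close> stands for \<open>\<xi>\<^sub>i\<close> and \<open>Inr i\<close> for \<open>z\<^sub>i\<close>.
  The operations \<open>0, 1, +, *\<close> of \<^theory>\<open>HOL-Library.Poly_Mapping\<close> on \<open>'n xzpoly\<close> are the usual
  polynomial ones.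
\<close>

type_synonym 'n monom = "('n + 'n) \<Rightarrow>\<^sub>0 nat"
type_synonym 'n xzpoly = "'n monom \<Rightarrow>\<^sub>0 complex"

definition scale :: "complex \<Rightarrow> ('a \<Rightarrow>\<^sub>0 complex) \<Rightarrow> ('a \<Rightarrow>\<^sub>0 complex)" where
  "scale c u = Poly_Mapping.map (\<lambda>x. c * x) u"

abbreviation linear_op :: "(('a \<Rightarrow>\<^sub>0 complex) \<Rightarrow> ('b \<Rightarrow>\<^sub>0 complex)) \<Rightarrow> bool" where
  "linear_op \<equiv> Vector_Spaces.linear scale scale"

text \<open>The formal partial derivative; the terms with exponent \<open>0\<close> in \<open>v\<close>, where the subtraction
  of exponents truncates, have coefficient \<open>0\<close>.\<close>

definition pdiff :: "'n + 'n \<Rightarrow> 'n xzpoly \<Rightarrow> 'n xzpoly" where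
  "pdiff v f = (\<Sum>m\<in>Poly_Mapping.keys f.
     Poly_Mapping.single (m - Poly_Mapping.single v 1)
       (of_nat (Poly_Mapping.lookup m v) * Poly_Mapping.lookup f m))"

definition d_z :: "'n \<Rightarrow> 'n xzpoly \<Rightarrow> 'n xzpoly" where
  "d_z i = pdiff (Inr i)"

definition d_xi :: "'n \<Rightarrow> 'n xzpoly \<Rightarrow> 'n xzpoly" where
  "d_xi i = pdiff (Inl i)"

text \<open>The tensor product of the free vector spaces on \<open>'a\<close> and \<open>'b\<close> is the free vector space on
  \<open>'a \<times> 'b\<close>, with \<open>single a 1 \<otimes> single b 1 = single (a, b) 1\<close>.\<close>

definition tensor :: "('a \<Rightarrow>\<^sub>0 complex) \<Rightarrow> ('b \<Rightarrow>\<^sub>0 complex) \<Rightarrow> ('a \<times> 'b \<Rightarrow>\<^sub>0 complex)" where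
  "tensor f g = (\<Sum>a\<in>Poly_Mapping.keys f. \<Sum>b\<in>Poly_Mapping.keys g.
     Poly_Mapping.single (a, b) (Poly_Mapping.lookup f a * Poly_Mapping.lookup g b))"

text \<open>For linear \<open>A\<close> and \<open>B\<close>, the linear map with \<open>f \<otimes> g \<mapsto> A f \<otimes> B g\<close>, given by its values on
  the basis.\<close>

definition tensor_op ::
  "(('a \<Rightarrow>\<^sub>0 complex) \<Rightarrow> ('c \<Rightarrow>\<^sub>0 complex)) \<Rightarrow> (('b \<Rightarrow>\<^sub>0 complex) \<Rightarrow> ('d \<Rightarrow>\<^sub>0 complex))
     \<Rightarrow> ('a \<times> 'b \<Rightarrow>\<^sub>0 complex) \<Rightarrow> ('c \<times> 'd \<Rightarrow>\<^sub>0 complex)" where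
  "tensor_op A B u = (\<Sum>p\<in>Poly_Mapping.keys u. scale (Poly_Mapping.lookup u p)
     (tensor (A (Poly_Mapping.single (fst p) 1)) (B (Poly_Mapping.single (snd p) 1))))"

text \<open>The linear map with \<open>f \<otimes> g \<mapsto> f * g\<close>; the product of the monomials \<open>m\<close> and \<open>m'\<close> is \<open>m + m'\<close>.\<close>

definition mu :: "('n monom \<times> 'n monom \<Rightarrow>\<^sub>0 complex) \<Rightarrow> 'n xzpoly" where
  "mu u = (\<Sum>p\<in>Poly_Mapping.keys u.
     Poly_Mapping.single (fst p + snd p) (Poly_Mapping.lookup u p))"

section \<open>The products and the map \<open>\<Phi>\<^sub>t\<close>\<close>

text \<open>\<open>exp_op s D\<close> is \<open>e\<^bsup>sD\<^esup>\<close> for a locally nilpotent \<open>D\<close>: for each argument \<open>u\<close> only finitely many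
  terms are nonzero, and \<^const>\<open>Sum_any\<close> is their sum (it would be \<open>0\<close> for infinitely many).\<close>

definition exp_op ::
  "complex \<Rightarrow> (('a \<Rightarrow>\<^sub>0 complex) \<Rightarrow> ('a \<Rightarrow>\<^sub>0 complex)) \<Rightarrow> ('a \<Rightarrow>\<^sub>0 complex) \<Rightarrow> ('a \<Rightarrow>\<^sub>0 complex)" where
  "exp_op s D u = Sum_any (\<lambda>m. scale (s ^ m / fact m) ((D ^^ m) u))"

definition Omega ::
  "('n::finite monom \<times> 'n monom \<Rightarrow>\<^sub>0 complex) \<Rightarrow> ('n monom \<times> 'n monom \<Rightarrow>\<^sub>0 complex)" where
  "Omega u = (\<Sum>i\<in>UNIV. tensor_op (d_z i) (d_xi i) u + tensor_op (d_xi i) (d_z i) u)"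

definition star :: "complex \<Rightarrow> 'n::finite xzpoly \<Rightarrow> 'n xzpoly \<Rightarrow> 'n xzpoly" where
  "star t f g = mu (exp_op (- t) Omega (tensor f g))"

definition Lambda :: "'n::finite xzpoly \<Rightarrow> 'n xzpoly" where
  "Lambda f = (\<Sum>i\<in>UNIV. d_xi i (d_z i f))"

definition Phi :: "complex \<Rightarrow> 'n::finite xzpoly \<Rightarrow> 'n xzpoly" where
  "Phi t = exp_op t Lambda"

abbreviation complex_ring :: "complex ring" where
  "complex_ring \<equiv> ring_of_type_algebra"

definition A_alg :: "(complex, 'n xzpoly) module" where
  "A_alg = \<lparr>carrier = UNIV, monoid.mult = (*), one = 1, ring.zero = 0, add = (+),
     module.smult = scale\<rparr>"

definition B_alg :: "complex \<Rightarrow> (complex, 'n::finite xzpoly) module" where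
  "B_alg t = \<lparr>carrier = UNIV, monoid.mult = star t, one = 1, ring.zero = 0, add = (+),
     module.smult = scale\<rparr>"

definition algebra_iso ::
  "('k, 'm) ring_scheme \<Rightarrow> ('k, 'a) module \<Rightarrow> ('k, 'b) module \<Rightarrow> ('a \<Rightarrow> 'b) \<Rightarrow> bool" where
  "algebra_iso K M N h \<longleftrightarrow> algebra K M \<and> algebra K N \<and> h \<in> ring_iso M N \<and>
     (\<forall>c\<in>carrier K. \<forall>x\<in>carrier M. h (c \<odot>\<^bsub>M\<^esub> x) = c \<odot>\<^bsub>N\<^esub> h x)"

section \<open>Deformations\<close>

text \<open>\<open>m\<close> is the sequence of coefficients of a product \<open>\<Sum>k. t\<^sup>k m\<^sub>k\<close> with formal parameter \<open>t\<close>.  The last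
  clause is associativity of that product, compared in degree \<open>k\<close>.\<close>

definition formal_deformation ::
  "(('a \<Rightarrow>\<^sub>0 complex) \<Rightarrow> ('a \<Rightarrow>\<^sub>0 complex) \<Rightarrow> ('a \<Rightarrow>\<^sub>0 complex))
     \<Rightarrow> (nat \<Rightarrow> ('a \<Rightarrow>\<^sub>0 complex) \<Rightarrow> ('a \<Rightarrow>\<^sub>0 complex) \<Rightarrow> ('a \<Rightarrow>\<^sub>0 complex)) \<Rightarrow> bool" where
  "formal_deformation prd m \<longleftrightarrow>
     m 0 = prd \<and>
     (\<forall>k f. linear_op (m k f)) \<and> (\<forall>k g. linear_op (\<lambda>f. m k f g)) \<and>
     (\<forall>k f g h. (\<Sum>i\<le>k. m i (m (k - i) f g) h) = (\<Sum>i\<le>k. m i f (m (k - i) g h)))"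

text \<open>The family \<open>\<Psi>\<^sub>t = \<Sum>k. t\<^sup>k \<psi>\<^sub>k\<close> with \<open>\<psi>\<^sub>0 = id\<close>; the last clause is
  \<open>\<Psi>\<^sub>t (f *\<^sub>t g) = \<Psi>\<^sub>t f \<cdot> \<Psi>\<^sub>t g\<close>, compared in degree \<open>k\<close>.\<close>

definition formally_trivial ::
  "(('a \<Rightarrow>\<^sub>0 complex) \<Rightarrow> ('a \<Rightarrow>\<^sub>0 complex) \<Rightarrow> ('a \<Rightarrow>\<^sub>0 complex))
     \<Rightarrow> (nat \<Rightarrow> ('a \<Rightarrow>\<^sub>0 complex) \<Rightarrow> ('a \<Rightarrow>\<^sub>0 complex) \<Rightarrow> ('a \<Rightarrow>\<^sub>0 complex)) \<Rightarrow> bool" where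
  "formally_trivial prd m \<longleftrightarrow>
     (\<exists>\<psi>. \<psi> 0 = id \<and> (\<forall>k. linear_op (\<psi> k)) \<and>
       (\<forall>k f g. (\<Sum>i\<le>k. \<psi> i (m (k - i) f g)) = (\<Sum>i\<le>k. prd (\<psi> i f) (\<psi> (k - i) g))))"

text \<open>A family of products indexed by \<open>t \<in> \<complex>\<close> is read with \<open>t\<close> as a formal parameter through its
  expansion in powers of \<open>t\<close>, with finitely many terms for each pair of arguments; the
  coefficients are determined by the family.\<close>

definition expansion ::
  "(complex \<Rightarrow> ('a \<Rightarrow>\<^sub>0 complex) \<Rightarrow> ('a \<Rightarrow>\<^sub>0 complex) \<Rightarrow> ('a \<Rightarrow>\<^sub>0 complex))
     \<Rightarrow> (nat \<Rightarrow> ('a \<Rightarrow>\<^sub>0 complex) \<Rightarrow> ('a \<Rightarrow>\<^sub>0 complex) \<Rightarrow> ('a \<Rightarrow>\<^sub>0 complex)) \<Rightarrow> bool" where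
  "expansion prds m \<longleftrightarrow> (\<forall>f g. finite {k. m k f g \<noteq> 0} \<and>
     (\<forall>t. prds t f g = (\<Sum>k | m k f g \<noteq> 0. scale (t ^ k) (m k f g))))"

definition trivial_deformation ::
  "(('a \<Rightarrow>\<^sub>0 complex) \<Rightarrow> ('a \<Rightarrow>\<^sub>0 complex) \<Rightarrow> ('a \<Rightarrow>\<^sub>0 complex))
     \<Rightarrow> (complex \<Rightarrow> ('a \<Rightarrow>\<^sub>0 complex) \<Rightarrow> ('a \<Rightarrow>\<^sub>0 complex) \<Rightarrow> ('a \<Rightarrow>\<^sub>0 complex)) \<Rightarrow> bool" where
  "trivial_deformation prd prds \<longleftrightarrow>
     (\<exists>m. expansion prds m \<and> formal_deformation prd m \<and> formally_trivial prd m)"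

end

theory Submission
  imports Defs "HOL-Computational_Algebra.Formal_Power_Series"
begin

text \<open>
  The operator \<open>\<Lambda>\<close> has order two, so its Leibniz rule on a product \<open>fg = \<mu>(f \<otimes> g)\<close> has, besides
  \<open>\<Lambda>f \<cdot> g + f \<cdot> \<Lambda>g\<close>, a cross term, and this cross term is exactly \<open>\<mu>(\<Omega>(f \<otimes> g))\<close>.  In other words
  \<open>\<Lambda> \<mu> = \<mu> (L + \<Omega>)\<close> with \<open>L = \<Lambda> \<otimes> 1 + 1 \<otimes> \<Lambda>\<close> (lemma \<open>Lambda_mu\<close>).  All operators in sight are built
  from partial derivatives and commute, so exponentials of sums are products of exponentials, and
  \<open>\<Phi>\<^sub>t(f *\<^sub>t g) = e\<^bsup>t\<Lambda>\<^esup> \<mu> e\<^bsup>-t\<Omega>\<^esup> (f \<otimes> g) = \<mu> e\<^bsup>t(L + \<Omega>)\<^esup> e\<^bsup>-t\<Omega>\<^esup> (f \<otimes> g) = \<mu> e\<^bsup>tL\<^esup> (f \<otimes> g) = \<Phi>\<^sub>t f \<cdot> \<Phi>\<^sub>t g\<close>.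

  This computation is carried out in each degree in \<open>t\<close> separately (lemma \<open>Lambda_star_coeff\<close>), with
  the divided powers \<open>D\<^sup>k / k!\<close> in place of the exponentials: the binomial theorem \<open>dpow_add\<close> is all that
  it uses.  In this form it is literally the statement that \<open>\<psi>\<^sub>k = \<Lambda>\<^sup>k / k!\<close> trivializes the formal
  deformation.  For a complex number \<open>t\<close> it is summed over the degrees, which is legitimate because
  \<open>\<Lambda>\<close> and \<open>\<Omega>\<close> lower degrees and are therefore locally nilpotent (lemma \<open>Phi_star\<close>).

  The algebra laws of the product \<open>*\<^sub>t\<close> need no computation: they are pulled back along the bijection
  \<open>\<Phi>\<^sub>t\<close>.  Associativity for formal \<open>t\<close> follows in the same way, as a series starting with the identity
  is injective on power series (lemma \<open>formal_assoc\<close>).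
\<close>

section \<open>Linear operators on spaces with a basis\<close>

lemma lookup_scale [simp]: "Poly_Mapping.lookup (scale c u) k = c * Poly_Mapping.lookup u k"
  unfolding scale_def by (simp add: map.rep_eq when_def)

interpretation pm: vector_space "scale :: complex \<Rightarrow> ('a \<Rightarrow>\<^sub>0 complex) \<Rightarrow> _"
  by unfold_locales (auto intro!: poly_mapping_eqI simp: lookup_add algebra_simps)

lemma linear_op_iff:
  "linear_op f \<longleftrightarrow> (\<forall>x y. f (x + y) = f x + f y) \<and> (\<forall>c x. f (scale c x) = scale c (f x))"
  by (simp add: Vector_Spaces.linear_iff pm.vector_space_axioms)

lemma linear_op_add: "linear_op f \<Longrightarrow> f (x + y) = f x + f y"
  by (simp add: linear_op_iff)

lemma linear_op_scale: "linear_op f \<Longrightarrow> f (scale c x) = scale c (f x)"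
  by (simp add: linear_op_iff)

lemma linear_op_zero: "linear_op f \<Longrightarrow> f 0 = 0"
  using linear_op_scale[of f 0 0] by simp

lemma linear_op_minus: "linear_op f \<Longrightarrow> f (- x) = - f x"
  using linear_op_scale[of f "-1" x] by simp

lemma linear_op_sum: "linear_op f \<Longrightarrow> f (sum g S) = (\<Sum>i\<in>S. f (g i))"
  by (induction S rule: infinite_finite_induct) (auto simp: linear_op_zero linear_op_add)

lemmas linear_op_simps =
  linear_op_add linear_op_scale linear_op_zero linear_op_minus linear_op_sum

lemma linear_op_id: "linear_op id"
  by (simp add: linear_op_iff)

lemma linear_op_compose: "linear_op f \<Longrightarrow> linear_op g \<Longrightarrow> linear_op (\<lambda>u. g (f u))"
  by (simp add: linear_op_iff)

lemma linear_op_plus: "linear_op f \<Longrightarrow> linear_op g \<Longrightarrow> linear_op (\<lambda>u. f u + g u)"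
  by (simp add: linear_op_iff pm.scale_right_distrib algebra_simps)

lemma linear_op_uminus: "linear_op f \<Longrightarrow> linear_op (\<lambda>u. - f u)"
  by (simp add: linear_op_iff)

lemma linear_op_scaled: "linear_op f \<Longrightarrow> linear_op (\<lambda>u. scale c (f u))"
  by (simp add: linear_op_iff pm.scale_right_distrib pm.scale_left_commute)

lemma linear_op_sums: "(\<And>i. i \<in> S \<Longrightarrow> linear_op (f i)) \<Longrightarrow> linear_op (\<lambda>u. \<Sum>i\<in>S. f i u)"
  by (simp add: linear_op_iff sum.distrib pm.scale_sum_right)

lemma linear_op_funpow:
  fixes D :: "('a \<Rightarrow>\<^sub>0 complex) \<Rightarrow> ('a \<Rightarrow>\<^sub>0 complex)"
  shows "linear_op D \<Longrightarrow> linear_op (D ^^ k)"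
  by (induction k) (simp_all add: linear_op_iff)

text \<open>Partial derivatives, \<open>\<mu>\<close> and tensor products of operators are all instances of linear extension
  from a basis, so their linearity comes from one lemma and identities between them can be checked
  on monomials.\<close>

definition lin_ext :: "('a \<Rightarrow> ('b \<Rightarrow>\<^sub>0 complex)) \<Rightarrow> ('a \<Rightarrow>\<^sub>0 complex) \<Rightarrow> ('b \<Rightarrow>\<^sub>0 complex)" where
  "lin_ext b u = (\<Sum>k\<in>Poly_Mapping.keys u. scale (Poly_Mapping.lookup u k) (b k))"

lemma lin_ext_superset:
  assumes "finite S" "Poly_Mapping.keys u \<subseteq> S"
  shows "lin_ext b u = (\<Sum>k\<in>S. scale (Poly_Mapping.lookup u k) (b k))"
  unfolding lin_ext_def
  by (rule sum.mono_neutral_left) (use assms in \<open>auto simp: in_keys_iff\<close>)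

lemma linear_op_lin_ext: "linear_op (lin_ext b)"
  unfolding linear_op_iff
proof (intro conjI allI)
  fix x y :: "'a \<Rightarrow>\<^sub>0 complex"
  let ?S = "Poly_Mapping.keys x \<union> Poly_Mapping.keys y"
  have "Poly_Mapping.keys (x + y) \<subseteq> ?S" by (rule keys_add)
  then show "lin_ext b (x + y) = lin_ext b x + lin_ext b y"
    by (simp add: lin_ext_superset[of ?S] lookup_add pm.scale_left_distrib sum.distrib)
next
  fix c :: complex and x :: "'a \<Rightarrow>\<^sub>0 complex"
  have "Poly_Mapping.keys (scale c x) \<subseteq> Poly_Mapping.keys x" by (auto simp: in_keys_iff)
  then show "lin_ext b (scale c x) = scale c (lin_ext b x)"
    by (simp add: lin_ext_superset[of "Poly_Mapping.keys x"] pm.scale_sum_right)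
qed

lemma lin_ext_single [simp]: "lin_ext b (Poly_Mapping.single a c) = scale c (b a)"
  by (simp add: lin_ext_def)

lemma scale_single [simp]: "scale c (Poly_Mapping.single a d) = Poly_Mapping.single a (c * d)"
  by (auto intro!: poly_mapping_eqI simp: lookup_single when_def)

lemma lin_ext_basis: "lin_ext (\<lambda>a. Poly_Mapping.single a 1) u = u"
  by (rule poly_mapping_eqI)
    (auto simp: lin_ext_def lookup_sum lookup_single when_def in_keys_iff)

lemma linear_op_eqI:
  assumes "linear_op A" "linear_op B"
    and "\<And>a. A (Poly_Mapping.single a 1) = B (Poly_Mapping.single a 1)"
  shows "A u = B u"
proof -
  have "A (lin_ext (\<lambda>a. Poly_Mapping.single a 1) u) = B (lin_ext (\<lambda>a. Poly_Mapping.single a 1) u)"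
    by (simp add: lin_ext_def linear_op_sum assms(1,2) linear_op_scale assms(3) del: scale_single)
  then show ?thesis by (simp only: lin_ext_basis)
qed

section \<open>Tensor products\<close>

lemma tensor_lin_ext:
  "tensor f g = lin_ext (\<lambda>a. lin_ext (\<lambda>b. Poly_Mapping.single (a, b) 1) g) f"
  by (simp add: tensor_def lin_ext_def pm.scale_sum_right)

lemma linear_op_tensor_left: "linear_op (\<lambda>f. tensor f g)"
  unfolding tensor_lin_ext by (rule linear_op_lin_ext)

lemma linear_op_tensor_right: "linear_op (tensor f)"
  unfolding tensor_lin_ext lin_ext_def[of _ f]
  by (intro linear_op_sums linear_op_scaled linear_op_lin_ext)

lemma tensor_single [simp]:
  "tensor (Poly_Mapping.single a c) (Poly_Mapping.single b d) = Poly_Mapping.single (a, b) (c * d)"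
  by (simp add: tensor_lin_ext)

lemma tensor_eqI:
  assumes "linear_op F" "linear_op G" and eq: "\<And>f g. F (tensor f g) = G (tensor f g)"
  shows "F u = G u"
proof (rule linear_op_eqI[OF assms(1,2)])
  fix p :: "'a \<times> 'b"
  show "F (Poly_Mapping.single p 1) = G (Poly_Mapping.single p 1)"
    using eq[of "Poly_Mapping.single (fst p) 1" "Poly_Mapping.single (snd p) 1"] by simp
qed

lemma bilinear_eqI:
  assumes "\<And>g. linear_op (\<lambda>f. F f g)" "\<And>f. linear_op (F f)"
    and "\<And>g. linear_op (\<lambda>f. G f g)" "\<And>f. linear_op (G f)"
    and "\<And>a b. F (Poly_Mapping.single a 1) (Poly_Mapping.single b 1)
           = G (Poly_Mapping.single a 1) (Poly_Mapping.single b 1)"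
  shows "F f g = G f g"
proof (rule linear_op_eqI[OF assms(1,3)])
  fix a
  show "F (Poly_Mapping.single a 1) g = G (Poly_Mapping.single a 1) g"
    by (rule linear_op_eqI[OF assms(2,4,5)])
qed

lemma tensor_op_lin_ext:
  "tensor_op A B = lin_ext (\<lambda>p. tensor (A (Poly_Mapping.single (fst p) 1))
                                        (B (Poly_Mapping.single (snd p) 1)))"
  by (simp add: fun_eq_iff tensor_op_def lin_ext_def)

lemma linear_op_tensor_op: "linear_op (tensor_op A B)"
  unfolding tensor_op_lin_ext by (rule linear_op_lin_ext)

lemma tensor_op_tensor:
  assumes "linear_op A" "linear_op B"
  shows "tensor_op A B (tensor f g) = tensor (A f) (B g)"
  by (rule bilinear_eqI[where F = "\<lambda>f g. tensor_op A B (tensor f g)"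
        and G = "\<lambda>f g. tensor (A f) (B g)"])
    (simp_all add: tensor_op_lin_ext linear_op_compose[OF linear_op_tensor_left linear_op_lin_ext]
      linear_op_compose[OF linear_op_tensor_right linear_op_lin_ext]
      linear_op_compose[OF assms(1) linear_op_tensor_left]
      linear_op_compose[OF assms(2) linear_op_tensor_right])

section \<open>Divided powers of an operator\<close>

text \<open>The coefficient of \<open>t\<^sup>k\<close> in \<open>e\<^bsup>tD\<^esup>\<close>.  Working with these coefficients serves a formal and a complex
  parameter \<open>t\<close> at once, and identities between them involve no infinite sums.\<close>

definition dpow :: "(('a \<Rightarrow>\<^sub>0 complex) \<Rightarrow> ('a \<Rightarrow>\<^sub>0 complex)) \<Rightarrow> nat \<Rightarrow> ('a \<Rightarrow>\<^sub>0 complex) \<Rightarrow> ('a \<Rightarrow>\<^sub>0 complex)"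
  where "dpow D k u = scale (1 / fact k) ((D ^^ k) u)"

lemma linear_op_dpow: "linear_op D \<Longrightarrow> linear_op (dpow D k)"
  unfolding dpow_def by (intro linear_op_scaled linear_op_funpow)

lemma dpow_0 [simp]: "dpow D 0 u = u"
  by (simp add: dpow_def)

lemma dpow_Suc:
  assumes "linear_op D"
  shows "scale (of_nat (Suc k)) (dpow D (Suc k) u) = D (dpow D k u)"
proof -
  have "of_nat (Suc k) * (1 / fact (Suc k)) = (1 / fact k :: complex)"
    by (simp add: divide_simps del: of_nat_Suc)
  then show ?thesis
    by (simp add: dpow_def linear_op_scale[OF assms] del: of_nat_Suc fact_Suc)
qed

lemma dpow_commute:
  assumes "linear_op A" "linear_op B" "\<And>u. A (B u) = B (A u)"
  shows "B (dpow A k u) = dpow A k (B u)"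
proof -
  have "B ((A ^^ k) u) = (A ^^ k) (B u)"
    by (induction k) (auto simp: assms(3)[symmetric])
  then show ?thesis by (simp add: dpow_def linear_op_scale assms(2))
qed

lemma dpow_intertwine:
  assumes "linear_op D" "linear_op M" "\<And>u. D (M u) = M (E u)"
  shows "dpow D k (M u) = M (dpow E k u)"
proof -
  have "(D ^^ k) (M u) = M ((E ^^ k) u)"
    by (induction k) (auto simp: assms(3))
  then show ?thesis by (simp add: dpow_def linear_op_scale assms(2))
qed

lemma dpow_uminus:
  assumes "linear_op D"
  shows "dpow (\<lambda>u. - D u) k u = scale ((- 1) ^ k) (dpow D k u)"
proof -
  have "((\<lambda>u. - D u) ^^ k) u = scale ((- 1) ^ k) ((D ^^ k) u)"
    by (induction k) (auto simp: linear_op_scale[OF assms])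
  then show ?thesis by (simp add: dpow_def pm.scale_left_commute)
qed

lemma dpow_zero: "0 < k \<Longrightarrow> dpow (\<lambda>u. 0) k u = 0"
  by (cases k) (auto simp: dpow_def)

text \<open>This is \<open>e\<^bsup>t(A+B)\<^esup> = e\<^bsup>tA\<^esup> e\<^bsup>tB\<^esup>\<close> in degree \<open>k\<close>.  Both sides \<open>S\<^sub>k\<close> satisfy the recurrence
  \<open>(k + 1) S\<^bsub>k+1\<^esub> = (A + B) S\<^sub>k\<close>, with the same initial value.\<close>

lemma dpow_add:
  assumes A: "linear_op A" and B: "linear_op B" and comm: "\<And>u. A (B u) = B (A u)"
  shows "dpow (\<lambda>u. A u + B u) k u = (\<Sum>i\<le>k. dpow A i (dpow B (k - i) u))"
proof (induction k)
  case 0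
  then show ?case by simp
next
  case (Suc k)
  let ?F = "\<lambda>i. dpow A i (dpow B (Suc k - i) u)"
  have AF: "A (dpow A i (dpow B (k - i) u)) = scale (of_nat (Suc i)) (?F (Suc i))" if "i \<le> k" for i
    using dpow_Suc[OF A, of i "dpow B (k - i) u"] by simp
  have BF: "B (dpow A i (dpow B (k - i) u)) = scale (of_nat (Suc k - i)) (?F i)" if "i \<le> k" for i
    using dpow_Suc[OF B, of "k - i" u] that
    by (simp add: dpow_commute[OF A B comm] Suc_diff_le flip: linear_op_scale[OF linear_op_dpow[OF A]]
        del: of_nat_Suc)
  have "scale (of_nat (Suc k)) (dpow (\<lambda>u. A u + B u) (Suc k) u)
      = A (\<Sum>i\<le>k. dpow A i (dpow B (k - i) u)) + B (\<Sum>i\<le>k. dpow A i (dpow B (k - i) u))"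
    by (simp only: dpow_Suc[OF linear_op_plus[OF A B]] Suc)
  also have "\<dots> = (\<Sum>i\<le>k. scale (of_nat (Suc i)) (?F (Suc i)))
                + (\<Sum>i\<le>k. scale (of_nat (Suc k - i)) (?F i))"
    by (simp add: linear_op_sum A B AF BF del: of_nat_Suc)
  \<comment> \<open>Both sums are extended by a term with coefficient \<open>0\<close>, so that the weights \<open>i\<close> and
    \<open>k + 1 - i\<close> add up to \<open>k + 1\<close> in each summand.\<close>
  also have "(\<Sum>i\<le>k. scale (of_nat (Suc i)) (?F (Suc i))) = (\<Sum>i\<le>Suc k. scale (of_nat i) (?F i))"
    by (subst sum.atMost_Suc_shift) simp
  also have "(\<Sum>i\<le>k. scale (of_nat (Suc k - i)) (?F i))
           = (\<Sum>i\<le>Suc k. scale (of_nat (Suc k - i)) (?F i))"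
    by simp
  also have "(\<Sum>i\<le>Suc k. scale (of_nat i) (?F i)) + (\<Sum>i\<le>Suc k. scale (of_nat (Suc k - i)) (?F i))
           = (\<Sum>i\<le>Suc k. scale (of_nat (Suc k)) (?F i))"
    unfolding sum.distrib[symmetric]
    by (rule sum.cong) (auto simp flip: pm.scale_left_distrib of_nat_add simp del: of_nat_Suc)
  also have "\<dots> = scale (of_nat (Suc k)) (\<Sum>i\<le>Suc k. ?F i)"
    by (simp only: pm.scale_sum_right)
  finally show ?case
    by (subst (asm) pm.scale_cancel_left) (simp del: sum.atMost_Suc of_nat_Suc)
qed

section \<open>Power series with finitely many terms\<close>

lemma finite_Cauchy_product:
  fixes F :: "nat \<Rightarrow> nat \<Rightarrow> 'a :: comm_monoid_add"
  assumes "\<And>i j. K \<le> i \<or> K \<le> j \<Longrightarrow> F i j = 0"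
  shows "(\<Sum>i<K. \<Sum>j<K. F i j) = (\<Sum>k<2 * K. \<Sum>i\<le>k. F i (k - i))"
proof -
  have "{(i, j). i + j < 2 * K} \<subseteq> {..<2 * K} \<times> {..<2 * K}" by auto
  then have "finite {(i, j). i + j < 2 * K}" by (rule finite_subset) simp
  then have "(\<Sum>(i, j)\<in>{..<K} \<times> {..<K}. F i j) = (\<Sum>(i, j)\<in>{(i, j). i + j < 2 * K}. F i j)"
    by (intro sum.mono_neutral_left) (auto intro!: assms simp: not_less)
  then show ?thesis by (simp add: sum.cartesian_product sum.triangle_reindex)
qed

lemma exp_op_dpow: "exp_op t D u = Sum_any (\<lambda>k. scale (t ^ k) (dpow D k u))"
  by (simp add: exp_op_def dpow_def)

definition locally_nilpotent :: "(('a \<Rightarrow>\<^sub>0 complex) \<Rightarrow> ('a \<Rightarrow>\<^sub>0 complex)) \<Rightarrow> bool" where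
  "locally_nilpotent D \<longleftrightarrow> (\<forall>u. \<forall>\<^sub>F k in sequentially. dpow D k u = 0)"

lemma exp_op_finite_sum:
  assumes "\<And>k. K \<le> k \<Longrightarrow> dpow D k u = 0"
  shows "exp_op t D u = (\<Sum>k<K. scale (t ^ k) (dpow D k u))"
  unfolding exp_op_dpow
proof (rule Sum_any.expand_superset)
  show "{k. scale (t ^ k) (dpow D k u) \<noteq> 0} \<subseteq> {..<K}"
  proof
    fix k assume "k \<in> {k. scale (t ^ k) (dpow D k u) \<noteq> 0}"
    then have "dpow D k u \<noteq> 0" by auto
    then show "k \<in> {..<K}" using assms[of k] by (cases "K \<le> k") auto
  qed
qed simp

lemma locally_nilpotentD:
  assumes "locally_nilpotent D"
  shows "\<exists>N. \<forall>k\<ge>N. dpow D k u = 0"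
  using assms unfolding locally_nilpotent_def eventually_sequentially by blast

lemma exp_op_eventually:
  assumes "locally_nilpotent D"
  shows "\<forall>\<^sub>F K in sequentially. exp_op t D u = (\<Sum>k<K. scale (t ^ k) (dpow D k u))"
proof -
  obtain N where "\<And>k. N \<le> k \<Longrightarrow> dpow D k u = 0"
    using locally_nilpotentD[OF assms, of u] by blast
  then have "exp_op t D u = (\<Sum>k<K. scale (t ^ k) (dpow D k u))" if "N \<le> K" for K
    using that by (intro exp_op_finite_sum) auto
  then show ?thesis
    unfolding eventually_sequentially by blast
qed

lemma linear_op_exp_op:
  assumes "linear_op D" "locally_nilpotent D"
  shows "linear_op (exp_op t D)"
  unfolding linear_op_iff
proof (intro conjI allI)
  fix x y
  have "\<forall>\<^sub>F K in sequentially. exp_op t D (x + y) = exp_op t D x + exp_op t D y"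
    using exp_op_eventually[OF assms(2), of t x] exp_op_eventually[OF assms(2), of t y]
      exp_op_eventually[OF assms(2), of t "x + y"]
    by eventually_elim
      (simp add: linear_op_simps linear_op_dpow assms pm.scale_right_distrib sum.distrib)
  then show "exp_op t D (x + y) = exp_op t D x + exp_op t D y" by simp
next
  fix c x
  have "\<forall>\<^sub>F K in sequentially. exp_op t D (scale c x) = scale c (exp_op t D x)"
    using exp_op_eventually[OF assms(2), of t x] exp_op_eventually[OF assms(2), of t "scale c x"]
    by eventually_elim
      (simp add: linear_op_simps linear_op_dpow assms pm.scale_sum_right mult.commute)
  then show "exp_op t D (scale c x) = scale c (exp_op t D x)" by simp
qed

text \<open>The Cauchy product of \<open>e\<^bsup>tD\<^esup>\<close> with a polynomial in \<open>t\<close>; this passes from identities between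
  coefficients to identities for complex \<open>t\<close>.  The upper limit is any large number, to make several
  such expansions comparable.\<close>

lemma exp_op_Cauchy:
  assumes D: "linear_op D" "locally_nilpotent D" and a: "\<And>j. N \<le> j \<Longrightarrow> a j = 0"
  shows "\<forall>\<^sub>F K in sequentially. exp_op t D (\<Sum>j<N. scale (t ^ j) (a j))
           = (\<Sum>k<K. scale (t ^ k) (\<Sum>i\<le>k. dpow D i (a (k - i))))"
proof -
  have ev: "\<forall>\<^sub>F K in sequentially. \<forall>j\<in>{..<N}. dpow D K (a j) = 0"
    using D(2) by (intro eventually_ball_finite) (auto simp: locally_nilpotent_def)
  \<comment> \<open>One bound serves all the finitely many \<open>a j\<close>.\<close>
  then obtain K0 where K0: "\<And>K j. K0 \<le> K \<Longrightarrow> j < N \<Longrightarrow> dpow D K (a j) = 0"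
    unfolding eventually_sequentially by auto
  have nil: "dpow D i (a j) = 0" if "max K0 N \<le> i \<or> max K0 N \<le> j" for i j
    using that K0[of i j] a[of j] by (cases "j < N") (auto simp: linear_op_zero linear_op_dpow D)
  show ?thesis
    unfolding eventually_sequentially
  proof (intro exI allI impI)
    fix M assume "2 * max K0 N \<le> M"
    let ?K = "max K0 N"
    have "exp_op t D (\<Sum>j<N. scale (t ^ j) (a j)) = exp_op t D (\<Sum>j<?K. scale (t ^ j) (a j))"
      by (intro arg_cong[of _ _ "exp_op t D"] sum.mono_neutral_left) (auto simp: a)
    also have "\<dots> = (\<Sum>i<?K. scale (t ^ i) (dpow D i (\<Sum>j<?K. scale (t ^ j) (a j))))"
      by (intro exp_op_finite_sum)
        (auto simp: linear_op_simps linear_op_dpow D nil intro!: sum.neutral)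
    also have "\<dots> = (\<Sum>i<?K. \<Sum>j<?K. scale (t ^ (i + j)) (dpow D i (a j)))"
      by (simp add: linear_op_simps linear_op_dpow D pm.scale_sum_right power_add)
    also have "\<dots> = (\<Sum>k<2 * ?K. \<Sum>i\<le>k. scale (t ^ (i + (k - i))) (dpow D i (a (k - i))))"
      by (rule finite_Cauchy_product) (auto simp: nil)
    also have "\<dots> = (\<Sum>k<2 * ?K. scale (t ^ k) (\<Sum>i\<le>k. dpow D i (a (k - i))))"
      by (simp add: pm.scale_sum_right)
    also have "\<dots> = (\<Sum>k<M. scale (t ^ k) (\<Sum>i\<le>k. dpow D i (a (k - i))))"
    proof (rule sum.mono_neutral_left)
      show "\<forall>k\<in>{..<M} - {..<2 * ?K}. scale (t ^ k) (\<Sum>i\<le>k. dpow D i (a (k - i))) = 0"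
        by (auto intro!: sum.neutral nil simp: pm.scale_eq_0_iff)
    qed (use \<open>2 * max K0 N \<le> M\<close> in auto)
    finally show "exp_op t D (\<Sum>j<N. scale (t ^ j) (a j))
        = (\<Sum>k<M. scale (t ^ k) (\<Sum>i\<le>k. dpow D i (a (k - i))))" .
  qed
qed


text \<open>Moving the sign from the parameter to the operator makes \<open>e\<^bsup>-tD\<^esup>\<close> a series in the same
  variable \<open>t\<close>, as is needed for Cauchy products.\<close>

lemma exp_op_uminus:
  assumes "linear_op D" "locally_nilpotent D"
  shows "exp_op (- t) D u = exp_op t (\<lambda>u. - D u) u"
  unfolding exp_op_dpow dpow_uminus[OF assms(1)] by (simp flip: power_mult_distrib)

lemma locally_nilpotent_uminus:
  "linear_op D \<Longrightarrow> locally_nilpotent D \<Longrightarrow> locally_nilpotent (\<lambda>u. - D u)"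
  by (simp add: locally_nilpotent_def dpow_uminus)

text \<open>The product \<open>e\<^bsup>tD\<^esup> e\<^bsup>-tD\<^esup>\<close> has the coefficients of \<open>e\<^bsup>t(D - D)\<^esup>\<close>, of which only the one in degree
  \<open>0\<close> is nonzero.\<close>

lemma exp_op_inverse:
  assumes D: "linear_op D" "locally_nilpotent D"
  shows "exp_op t D (exp_op (- t) D u) = u"
proof -
  let ?E = "\<lambda>u. - D u"
  obtain N where N: "\<And>k. N \<le> k \<Longrightarrow> dpow ?E k u = 0"
    using locally_nilpotentD[OF locally_nilpotent_uminus[OF D], of u] by blast
  have E: "exp_op t ?E u = (\<Sum>k<N. scale (t ^ k) (dpow ?E k u))"
    by (rule exp_op_finite_sum) (rule N)
  have *: "(\<Sum>i\<le>k. dpow D i (dpow ?E (k - i) u)) = dpow (\<lambda>u. 0) k u" for k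
    by (subst dpow_add[symmetric]) (simp_all add: D linear_op_uminus linear_op_minus)
  have C: "\<forall>\<^sub>F K in sequentially. exp_op t D (\<Sum>k<N. scale (t ^ k) (dpow ?E k u))
      = (\<Sum>k<K. scale (t ^ k) (\<Sum>i\<le>k. dpow D i (dpow ?E (k - i) u)))"
    by (rule exp_op_Cauchy[OF D]) (rule N)
  have "\<forall>\<^sub>F K in sequentially. exp_op t D (exp_op t ?E u) = u"
    unfolding E
    using C eventually_gt_at_top[of 0]
  proof eventually_elim
    case (elim K)
    obtain M where "K = Suc M" using elim(2) gr0_implies_Suc by blast
    then show ?case
      using elim(1) by (simp add: * dpow_zero sum.lessThan_Suc_shift del: sum.lessThan_Suc)
  qed
  then show ?thesis by (simp add: exp_op_uminus[OF D])
qed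

lemma exp_op_kernel:
  assumes "linear_op D" "D u = 0"
  shows "exp_op t D u = u"
proof -
  have "dpow D k u = 0" if k: "1 \<le> k" for k
  proof -
    obtain j where "k = Suc j" using k by (cases k) auto
    then have "(D ^^ k) u = 0"
      using assms(2) linear_op_zero[OF linear_op_funpow[OF assms(1)]] by (simp add: funpow_swap1)
    then show ?thesis by (simp add: dpow_def)
  qed
  from exp_op_finite_sum[of 1, OF this] show ?thesis by simp
qed

section \<open>Operators lowering a weight\<close>

definition lowers :: "('a \<Rightarrow> nat) \<Rightarrow> (('a \<Rightarrow>\<^sub>0 complex) \<Rightarrow> ('a \<Rightarrow>\<^sub>0 complex)) \<Rightarrow> bool" where
  "lowers w D \<longleftrightarrow> (\<forall>a. \<forall>b\<in>Poly_Mapping.keys (D (Poly_Mapping.single a 1)). w b < w a)"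

lemma keys_sum_obtain:
  assumes "b \<in> Poly_Mapping.keys (\<Sum>i\<in>S. F i)"
  obtains i where "i \<in> S" "b \<in> Poly_Mapping.keys (F i)"
  using assms keys_sum[of F S] by blast

lemma lowers_keys:
  assumes "linear_op D" "lowers w D" "b \<in> Poly_Mapping.keys (D u)"
  shows "\<exists>a\<in>Poly_Mapping.keys u. w b < w a"
proof -
  have "D u = lin_ext (\<lambda>a. D (Poly_Mapping.single a 1)) u"
    by (rule linear_op_eqI[OF assms(1) linear_op_lin_ext]) simp
  with assms(3) have "b \<in> Poly_Mapping.keys (\<Sum>a\<in>Poly_Mapping.keys u.
      scale (Poly_Mapping.lookup u a) (D (Poly_Mapping.single a 1)))"
    by (simp add: lin_ext_def)
  then obtain a where a: "a \<in> Poly_Mapping.keys u"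
      "b \<in> Poly_Mapping.keys (scale (Poly_Mapping.lookup u a) (D (Poly_Mapping.single a 1)))"
    by (rule keys_sum_obtain)
  then have "b \<in> Poly_Mapping.keys (D (Poly_Mapping.single a 1))" by (simp add: in_keys_iff)
  with a(1) assms(2) show ?thesis unfolding lowers_def by blast
qed

text \<open>A nonzero \<open>D\<^sup>k u\<close> forces \<open>u\<close> to contain a basis element of weight at least \<open>k\<close>, since weights are
  natural numbers.\<close>

lemma lowers_locally_nilpotent:
  assumes "linear_op D" "lowers w D"
  shows "locally_nilpotent D"
  unfolding locally_nilpotent_def eventually_sequentially
proof (intro allI exI impI)
  \<comment> \<open>The sum is a convenient upper bound for the weights occurring in \<open>u\<close>.\<close>
  fix u :: "'a \<Rightarrow>\<^sub>0 complex" and k assume k: "(\<Sum>a\<in>Poly_Mapping.keys u. w a) + 1 \<le> k"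
  have *: "\<exists>a\<in>Poly_Mapping.keys u. w b + j \<le> w a" if "b \<in> Poly_Mapping.keys ((D ^^ j) u)" for b j
    using that
  proof (induction j arbitrary: b)
    case (Suc j)
    obtain c where "c \<in> Poly_Mapping.keys ((D ^^ j) u)" "w b < w c"
      using lowers_keys[OF assms, of b "(D ^^ j) u"] Suc.prems by auto
    with Suc.IH[of c] show ?case by force
  qed auto
  have "Poly_Mapping.keys ((D ^^ k) u) = {}"
  proof (rule ccontr)
    assume "Poly_Mapping.keys ((D ^^ k) u) \<noteq> {}"
    then obtain b where "b \<in> Poly_Mapping.keys ((D ^^ k) u)" by blast
    then obtain a where a: "a \<in> Poly_Mapping.keys u" "w b + k \<le> w a" using * by blast
    have "w a \<le> (\<Sum>a\<in>Poly_Mapping.keys u. w a)" by (rule member_le_sum[OF a(1)]) auto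
    with a(2) k show False by simp
  qed
  then show "dpow D k u = 0" by (simp add: dpow_def)
qed

section \<open>Multiplication and partial derivatives\<close>

lemma scale_conv_mult: "scale c f = Poly_Mapping.single 0 c * f"
  unfolding scale_def by (simp add: mult_map_scale_conv_mult)

lemma linear_op_times_left: "linear_op (\<lambda>f. f * (g :: 'n xzpoly))"
  by (simp add: linear_op_iff distrib_right scale_conv_mult mult.assoc)

lemma linear_op_times_right: "linear_op (\<lambda>g. (f :: 'n xzpoly) * g)"
  by (simp add: linear_op_iff distrib_left scale_conv_mult mult.left_commute)

lemma mu_lin_ext: "mu = lin_ext (\<lambda>p. Poly_Mapping.single (fst p + snd p) 1)"
  by (simp add: fun_eq_iff mu_def lin_ext_def)

lemma linear_op_mu: "linear_op mu"
  unfolding mu_lin_ext by (rule linear_op_lin_ext)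

lemma mu_tensor: "mu (tensor f g) = f * g"
  by (rule bilinear_eqI[where F = "\<lambda>f g. mu (tensor f g)" and G = "(*)"])
    (simp_all add: mu_lin_ext linear_op_times_left linear_op_times_right mult_single
      linear_op_compose[OF linear_op_tensor_left linear_op_lin_ext]
      linear_op_compose[OF linear_op_tensor_right linear_op_lin_ext])

lemma pdiff_lin_ext: "pdiff v = lin_ext (\<lambda>m. Poly_Mapping.single (m - Poly_Mapping.single v 1)
    (of_nat (Poly_Mapping.lookup m v)))"
  by (simp add: fun_eq_iff pdiff_def lin_ext_def mult.commute)

lemma linear_op_pdiff: "linear_op (pdiff v)"
  unfolding pdiff_lin_ext by (rule linear_op_lin_ext)

lemma pdiff_single: "pdiff v (Poly_Mapping.single m c) =
   Poly_Mapping.single (m - Poly_Mapping.single v 1) (c * of_nat (Poly_Mapping.lookup m v))"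
  by (simp add: pdiff_lin_ext)

text \<open>Truncated subtraction of exponents is harmless where the coefficient
  \<^term>\<open>Poly_Mapping.lookup m v\<close> of the derivative is nonzero.\<close>

lemma diff_single_plus:
  assumes "Poly_Mapping.lookup m v \<noteq> 0"
  shows "(m :: 'a \<Rightarrow>\<^sub>0 nat) - Poly_Mapping.single v 1 + m' = m + m' - Poly_Mapping.single v 1"
  using assms by (auto intro!: poly_mapping_eqI simp: lookup_add lookup_minus lookup_single when_def)

lemma pdiff_mult: "pdiff v (f * g) = pdiff v f * g + f * pdiff v g"
proof (rule bilinear_eqI[where F = "\<lambda>f g. pdiff v (f * g)"
    and G = "\<lambda>f g. pdiff v f * g + f * pdiff v g"])
  fix a b :: "'a monom"
  let ?s = "\<lambda>m. Poly_Mapping.single m (1 :: complex)"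
  have 1: "Poly_Mapping.single (a - Poly_Mapping.single v 1 + b) (of_nat (Poly_Mapping.lookup a v))
      = Poly_Mapping.single (a + b - Poly_Mapping.single v 1) (of_nat (Poly_Mapping.lookup a v) :: complex)"
    by (cases "Poly_Mapping.lookup a v = 0") (simp, subst diff_single_plus, simp_all)
  have 2: "Poly_Mapping.single (a + (b - Poly_Mapping.single v 1)) (of_nat (Poly_Mapping.lookup b v))
      = Poly_Mapping.single (a + b - Poly_Mapping.single v 1) (of_nat (Poly_Mapping.lookup b v) :: complex)"
    by (cases "Poly_Mapping.lookup b v = 0")
      (simp, subst add.commute, subst diff_single_plus, simp_all add: add.commute)
  show "pdiff v (?s a * ?s b) = pdiff v (?s a) * ?s b + ?s a * pdiff v (?s b)"
    by (simp add: pdiff_single mult_single lookup_add 1[simplified] 2[simplified] flip: single_add)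
qed (simp_all add: linear_op_plus linear_op_compose[OF linear_op_times_left linear_op_pdiff]
      linear_op_compose[OF linear_op_times_right linear_op_pdiff]
      linear_op_compose[OF linear_op_pdiff linear_op_times_left]
      linear_op_compose[OF linear_op_pdiff linear_op_times_right]
      linear_op_times_left linear_op_times_right)

lemma pdiff_commute: "pdiff v (pdiff w f) = pdiff w (pdiff v f)"
proof (rule linear_op_eqI[where A = "\<lambda>f. pdiff v (pdiff w f)" and B = "\<lambda>f. pdiff w (pdiff v f)"])
  show "linear_op (\<lambda>f. pdiff v (pdiff w f))" "linear_op (\<lambda>f. pdiff w (pdiff v f))"
    by (rule linear_op_compose[OF linear_op_pdiff linear_op_pdiff])+
  have "m - Poly_Mapping.single v 1 - Poly_Mapping.single w 1
      = m - Poly_Mapping.single w 1 - Poly_Mapping.single v 1" for m :: "'a monom"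
    by (rule poly_mapping_eqI) (simp add: lookup_minus)
  then show "pdiff v (pdiff w (Poly_Mapping.single m 1)) = pdiff w (pdiff v (Poly_Mapping.single m 1))" for m
    by (cases "v = w")
      (simp_all add: pdiff_single lookup_minus lookup_single mult.commute)
qed

definition total_degree :: "'n::finite monom \<Rightarrow> nat" where
  "total_degree m = (\<Sum>v\<in>UNIV. Poly_Mapping.lookup m v)"

lemma lowers_pdiff: "lowers total_degree (pdiff (v :: 'n + 'n::finite))"
  unfolding lowers_def
proof (intro allI ballI)
  fix m b :: "'n monom"
  assume "b \<in> Poly_Mapping.keys (pdiff v (Poly_Mapping.single m 1))"
  then have b: "b = m - Poly_Mapping.single v 1" and "Poly_Mapping.lookup m v \<noteq> 0"
    by (auto simp: pdiff_single split: if_splits)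
  then show "total_degree b < total_degree m"
    unfolding total_degree_def
  proof (intro sum_strict_mono_ex1)
    show "\<exists>a\<in>UNIV. Poly_Mapping.lookup b a < Poly_Mapping.lookup m a"
      using \<open>Poly_Mapping.lookup m v \<noteq> 0\<close> by (intro bexI[of _ v]) (simp_all add: b lookup_minus)
  qed (simp_all add: b lookup_minus)
qed


section \<open>The operators \<open>\<Lambda>\<close> and \<open>\<Omega>\<close>\<close>

lemma linear_op_d_z: "linear_op (d_z i)" and linear_op_d_xi: "linear_op (d_xi i)"
  by (simp_all add: d_z_def d_xi_def linear_op_pdiff)

lemma linear_op_Lambda: "linear_op Lambda"
  unfolding Lambda_def
  by (intro linear_op_sums linear_op_compose[OF linear_op_d_z linear_op_d_xi])

lemma linear_op_Omega: "linear_op Omega"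
  unfolding Omega_def by (intro linear_op_sums linear_op_plus linear_op_tensor_op)

lemma pdiff_Lambda: "pdiff v (Lambda f) = Lambda (pdiff v f)"
  by (simp add: Lambda_def linear_op_sum linear_op_pdiff d_z_def d_xi_def pdiff_commute[of v])

lemma d_z_Lambda: "d_z i (Lambda f) = Lambda (d_z i f)"
  and d_xi_Lambda: "d_xi i (Lambda f) = Lambda (d_xi i f)"
  by (simp_all add: d_z_def d_xi_def pdiff_Lambda)

lemma Omega_tensor:
  "Omega (tensor f g) = (\<Sum>i\<in>UNIV. tensor (d_z i f) (d_xi i g) + tensor (d_xi i f) (d_z i g))"
  by (simp add: Omega_def tensor_op_tensor linear_op_d_z linear_op_d_xi)

text \<open>The cross terms \<open>\<partial>\<^sub>i f \<cdot> \<delta>\<^sub>i g + \<delta>\<^sub>i f \<cdot> \<partial>\<^sub>i g\<close> of the second-order Leibniz rule are what \<open>\<Omega>\<close> records.\<close>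

lemma Lambda_mult:
  "Lambda (f * g) = Lambda f * g + f * Lambda g + mu (Omega (tensor f g))"
  by (simp add: Lambda_def Omega_tensor linear_op_simps linear_op_mu mu_tensor d_z_def d_xi_def
      pdiff_mult linear_op_pdiff sum_distrib_left sum_distrib_right sum.distrib algebra_simps)

lemma locally_nilpotent_Lambda: "locally_nilpotent (Lambda :: 'n::finite xzpoly \<Rightarrow> _)"
proof (rule lowers_locally_nilpotent[OF linear_op_Lambda, of total_degree], unfold lowers_def, intro allI ballI)
  fix m b :: "'n monom"
  assume "b \<in> Poly_Mapping.keys (Lambda (Poly_Mapping.single m 1))"
  then obtain i where "b \<in> Poly_Mapping.keys (d_xi i (d_z i (Poly_Mapping.single m 1)))"
    unfolding Lambda_def by (rule keys_sum_obtain)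
  then obtain a where "a \<in> Poly_Mapping.keys (d_z i (Poly_Mapping.single m 1))" "total_degree b < total_degree a"
    unfolding d_xi_def using lowers_keys[OF linear_op_pdiff lowers_pdiff] by blast
  moreover from this(1) have "total_degree a < total_degree m"
    unfolding d_z_def using lowers_pdiff unfolding lowers_def by blast
  ultimately show "total_degree b < total_degree m" by simp
qed

lemma keys_tensor: "Poly_Mapping.keys (tensor f g) \<subseteq> Poly_Mapping.keys f \<times> Poly_Mapping.keys g"
  unfolding tensor_def by (auto elim!: keys_sum_obtain split: if_splits)

text \<open>Each summand of \<open>\<Omega>\<close> differentiates the first tensor factor, whose degree can thus serve as
  the weight.\<close>

lemma locally_nilpotent_Omega:
  "locally_nilpotent (Omega :: ('n::finite monom \<times> 'n monom \<Rightarrow>\<^sub>0 complex) \<Rightarrow> _)"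
proof (rule lowers_locally_nilpotent[OF linear_op_Omega, of "\<lambda>p. total_degree (fst p)"], unfold lowers_def, intro allI ballI)
  fix p b :: "'n monom \<times> 'n monom"
  let ?f = "Poly_Mapping.single (fst p) 1" and ?g = "Poly_Mapping.single (snd p) 1"
  assume "b \<in> Poly_Mapping.keys (Omega (Poly_Mapping.single p 1))"
  then have "b \<in> Poly_Mapping.keys (Omega (tensor ?f ?g))" by simp
  then obtain i where "b \<in> Poly_Mapping.keys (tensor (d_z i ?f) (d_xi i ?g) + tensor (d_xi i ?f) (d_z i ?g))"
    unfolding Omega_tensor by (rule keys_sum_obtain)
  then have "fst b \<in> Poly_Mapping.keys (d_z i ?f) \<or> fst b \<in> Poly_Mapping.keys (d_xi i ?f)"
    using Poly_Mapping.keys_add keys_tensor by fastforce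
  then show "total_degree (fst b) < total_degree (fst p)"
    unfolding d_z_def d_xi_def using lowers_pdiff unfolding lowers_def by blast
qed

section \<open>The transport identity\<close>

text \<open>The operator \<open>\<Lambda> \<otimes> 1 + 1 \<otimes> \<Lambda>\<close>, by which \<open>\<Lambda>\<close> would act on products if it were a derivation.\<close>

definition Leibniz :: "('n::finite monom \<times> 'n monom \<Rightarrow>\<^sub>0 complex) \<Rightarrow> ('n monom \<times> 'n monom \<Rightarrow>\<^sub>0 complex)"
  where "Leibniz u = tensor_op Lambda id u + tensor_op id Lambda u"

lemma linear_op_Leibniz: "linear_op Leibniz"
  unfolding Leibniz_def by (intro linear_op_plus linear_op_tensor_op)

lemma Leibniz_tensor: "Leibniz (tensor f g) = tensor (Lambda f) g + tensor f (Lambda g)"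
  by (simp add: Leibniz_def tensor_op_tensor linear_op_Lambda linear_op_id)

lemma Lambda_mu: "Lambda (mu u) = mu (Leibniz u + Omega u)"
proof (rule tensor_eqI[where F = "\<lambda>u. Lambda (mu u)" and G = "\<lambda>u. mu (Leibniz u + Omega u)"])
  show "linear_op (\<lambda>u. Lambda (mu u))" by (rule linear_op_compose[OF linear_op_mu linear_op_Lambda])
  show "linear_op (\<lambda>u. mu (Leibniz u + Omega u))"
    by (rule linear_op_compose[OF linear_op_plus[OF linear_op_Leibniz linear_op_Omega] linear_op_mu])
  show "Lambda (mu (tensor f g)) = mu (Leibniz (tensor f g) + Omega (tensor f g))" for f g :: "'a xzpoly"
    by (simp add: Lambda_mult mu_tensor Leibniz_tensor linear_op_add linear_op_mu)
qed

text \<open>Both operators have constant coefficients.\<close>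

lemma Leibniz_Omega: "Leibniz (Omega u) = Omega (Leibniz u)"
proof (rule tensor_eqI[where F = "\<lambda>u. Leibniz (Omega u)" and G = "\<lambda>u. Omega (Leibniz u)"])
  show "Leibniz (Omega (tensor f g)) = Omega (Leibniz (tensor f g))" for f g :: "'a xzpoly"
    by (simp add: Leibniz_tensor Omega_tensor linear_op_simps linear_op_Leibniz linear_op_Omega
        d_z_Lambda d_xi_Lambda sum.distrib add_ac)
qed (rule linear_op_compose[OF linear_op_Omega linear_op_Leibniz]
      linear_op_compose[OF linear_op_Leibniz linear_op_Omega])+

text \<open>The two summands \<open>\<Lambda> \<otimes> 1\<close> and \<open>1 \<otimes> \<Lambda>\<close> commute, so this is \<open>e\<^bsup>tL\<^esup> = e\<^bsup>t\<Lambda>\<^esup> \<otimes> e\<^bsup>t\<Lambda>\<^esup>\<close> in degree \<open>k\<close>.\<close>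

lemma dpow_Leibniz_tensor:
  "dpow Leibniz k (tensor f g) = (\<Sum>i\<le>k. tensor (dpow Lambda i f) (dpow Lambda (k - i) g))"
proof -
  let ?P = "tensor_op Lambda id" and ?Q = "tensor_op id Lambda"
  have P: "dpow ?P i (tensor f g) = tensor (dpow Lambda i f) g" for i f g
    by (rule dpow_intertwine[OF linear_op_tensor_op linear_op_tensor_left])
      (simp add: tensor_op_tensor linear_op_Lambda linear_op_id)
  have Q: "dpow ?Q i (tensor f g) = tensor f (dpow Lambda i g)" for i f g
    by (rule dpow_intertwine[OF linear_op_tensor_op linear_op_tensor_right])
      (simp add: tensor_op_tensor linear_op_Lambda linear_op_id)
  have "?P (?Q u) = ?Q (?P u)" for u
    by (rule tensor_eqI[where F = "\<lambda>u. ?P (?Q u)" and G = "\<lambda>u. ?Q (?P u)"])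
      (simp_all add: linear_op_compose[OF linear_op_tensor_op linear_op_tensor_op]
        tensor_op_tensor linear_op_Lambda linear_op_id)
  then have "dpow (\<lambda>u. ?P u + ?Q u) k (tensor f g) = (\<Sum>i\<le>k. dpow ?P i (dpow ?Q (k - i) (tensor f g)))"
    by (intro dpow_add linear_op_tensor_op)
  then show ?thesis by (simp add: P Q Leibniz_def[abs_def])
qed

text \<open>The coefficient of \<open>t\<^sup>k\<close> in \<open>f *\<^sub>t g\<close>.\<close>

definition star_coeff :: "nat \<Rightarrow> 'n::finite xzpoly \<Rightarrow> 'n xzpoly \<Rightarrow> 'n xzpoly" where
  "star_coeff k f g = mu (dpow (\<lambda>u. - Omega u) k (tensor f g))"

text \<open>This is \<open>\<Phi>\<^sub>t(f *\<^sub>t g) = \<Phi>\<^sub>t f \<cdot> \<Phi>\<^sub>t g\<close> in degree \<open>k\<close>.  Moving \<open>\<Lambda>\<close> past \<open>\<mu>\<close> turns it into \<open>L + \<Omega>\<close>, and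
  then \<open>\<Omega>\<close> cancels against the exponent \<open>-\<Omega>\<close> of the product.\<close>

lemma Lambda_star_coeff:
  "(\<Sum>i\<le>k. dpow Lambda i (star_coeff (k - i) f g)) = (\<Sum>i\<le>k. dpow Lambda i f * dpow Lambda (k - i) g)"
proof -
  let ?LO = "\<lambda>u. Leibniz u + Omega u" and ?O = "\<lambda>u. - Omega u"
  have "dpow Lambda i (mu u) = mu (dpow ?LO i u)" for i and u :: "'a monom \<times> 'a monom \<Rightarrow>\<^sub>0 complex"
    by (rule dpow_intertwine[OF linear_op_Lambda linear_op_mu]) (rule Lambda_mu)
  then have "(\<Sum>i\<le>k. dpow Lambda i (star_coeff (k - i) f g))
      = mu (\<Sum>i\<le>k. dpow ?LO i (dpow ?O (k - i) (tensor f g)))"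
    by (simp only: star_coeff_def linear_op_sum[OF linear_op_mu])
  also have "(\<Sum>i\<le>k. dpow ?LO i (dpow ?O (k - i) (tensor f g)))
      = dpow (\<lambda>u. ?LO u + ?O u) k (tensor f g)"
  proof (rule dpow_add[symmetric])
    show "linear_op ?LO" "linear_op ?O"
      by (intro linear_op_plus linear_op_uminus linear_op_Leibniz linear_op_Omega)+
    show "?LO (?O u) = ?O (?LO u)" for u
      by (simp only: linear_op_minus[OF linear_op_Leibniz] linear_op_minus[OF linear_op_Omega]
          linear_op_add[OF linear_op_Omega] Leibniz_Omega minus_add_distrib)
  qed
  also have "mu \<dots> = (\<Sum>i\<le>k. dpow Lambda i f * dpow Lambda (k - i) g)"
    by (simp add: dpow_Leibniz_tensor linear_op_sum[OF linear_op_mu] mu_tensor)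
  finally show ?thesis .
qed

section \<open>Polynomial dependence on \<open>t\<close>\<close>

lemma star_coeff_eventually: "\<forall>\<^sub>F k in sequentially. star_coeff k f g = 0"
proof -
  have "\<forall>\<^sub>F k in sequentially. dpow (\<lambda>u. - Omega u) k (tensor f g) = 0"
    by (rule locally_nilpotent_uminus[OF linear_op_Omega locally_nilpotent_Omega,
          unfolded locally_nilpotent_def, rule_format])
  then show ?thesis
    by eventually_elim (simp add: star_coeff_def linear_op_zero linear_op_mu)
qed

lemma star_expansion:
  "\<forall>\<^sub>F K in sequentially. star t f g = (\<Sum>k<K. scale (t ^ k) (star_coeff k f g))"
proof -
  note nil = locally_nilpotent_uminus[OF linear_op_Omega locally_nilpotent_Omega]
  show ?thesis
    using exp_op_eventually[OF nil, of t "tensor f g"]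
    by eventually_elim (simp add: star_def exp_op_uminus linear_op_Omega locally_nilpotent_Omega
        star_coeff_def linear_op_simps linear_op_mu)
qed

lemma star_finite_sum:
  assumes "\<And>k. K \<le> k \<Longrightarrow> star_coeff k f g = 0"
  shows "star t f g = (\<Sum>k<K. scale (t ^ k) (star_coeff k f g))"
proof -
  have "\<forall>\<^sub>F M in sequentially. star t f g = (\<Sum>k<K. scale (t ^ k) (star_coeff k f g))"
    using star_expansion[of t f g] eventually_ge_at_top[of K]
  proof eventually_elim
    case (elim M)
    have "(\<Sum>k<M. scale (t ^ k) (star_coeff k f g)) = (\<Sum>k<K. scale (t ^ k) (star_coeff k f g))"
      by (rule sum.mono_neutral_right) (use elim assms in auto)
    with elim show ?case by simp
  qed
  then show ?thesis by simp
qed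

lemma linear_op_Phi: "linear_op (Phi t)"
  unfolding Phi_def by (rule linear_op_exp_op[OF linear_op_Lambda locally_nilpotent_Lambda])

lemma Phi_inverse: "Phi t (Phi (- t) f) = f"
  unfolding Phi_def by (rule exp_op_inverse[OF linear_op_Lambda locally_nilpotent_Lambda])

lemma bij_Phi: "bij (Phi t)"
  by (rule o_bij[of "Phi (- t)"]) (use Phi_inverse[of "- t"] in \<open>auto simp: fun_eq_iff Phi_inverse\<close>)

lemma Phi_one: "Phi t 1 = 1"
proof -
  have "pdiff v 1 = 0" for v :: "'a + 'a"
    using pdiff_single[of v 0 1] by simp
  then have "Lambda 1 = (0 :: 'a xzpoly)"
    by (simp add: Lambda_def d_z_def d_xi_def linear_op_zero linear_op_pdiff)
  then show ?thesis unfolding Phi_def by (rule exp_op_kernel[OF linear_op_Lambda])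
qed

lemma Phi_star: "Phi t (star t f g) = Phi t f * Phi t g"
proof -
  obtain N where N: "\<And>k. N \<le> k \<Longrightarrow> star_coeff k f g = 0"
    using star_coeff_eventually[of f g] unfolding eventually_sequentially by blast
  have S: "star t f g = (\<Sum>k<N. scale (t ^ k) (star_coeff k f g))"
    by (rule star_finite_sum) (rule N)
  have C: "\<forall>\<^sub>F K in sequentially. Phi t (star t f g)
      = (\<Sum>k<K. scale (t ^ k) (\<Sum>i\<le>k. dpow Lambda i (star_coeff (k - i) f g)))"
    unfolding Phi_def S
    by (rule exp_op_Cauchy[OF linear_op_Lambda locally_nilpotent_Lambda]) (rule N)
  obtain K1 where K1: "\<And>K. K1 \<le> K \<Longrightarrow> Phi t (star t f g)
      = (\<Sum>k<K. scale (t ^ k) (\<Sum>i\<le>k. dpow Lambda i (star_coeff (k - i) f g)))"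
    using C unfolding eventually_sequentially by blast
  obtain K2 where K2: "\<And>i. K2 \<le> i \<Longrightarrow> dpow Lambda i f = 0"
    using locally_nilpotentD[OF locally_nilpotent_Lambda, of f] by blast
  obtain K3 where K3: "\<And>i. K3 \<le> i \<Longrightarrow> dpow Lambda i g = 0"
    using locally_nilpotentD[OF locally_nilpotent_Lambda, of g] by blast
  let ?K = "K1 + K2 + K3"
  have "Phi t f * Phi t g
      = (\<Sum>i<?K. scale (t ^ i) (dpow Lambda i f)) * (\<Sum>j<?K. scale (t ^ j) (dpow Lambda j g))"
    unfolding Phi_def
    by (intro arg_cong2[of _ _ _ _ "(*)"] exp_op_finite_sum) (auto intro!: K2 K3)
  also have "\<dots> = (\<Sum>i<?K. \<Sum>j<?K. scale (t ^ (i + j)) (dpow Lambda i f * dpow Lambda j g))"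
    by (simp add: sum_product power_add linear_op_scale[OF linear_op_times_left]
        linear_op_scale[OF linear_op_times_right] mult.commute)
  also have "\<dots> = (\<Sum>k<2 * ?K. \<Sum>i\<le>k. scale (t ^ (i + (k - i))) (dpow Lambda i f * dpow Lambda (k - i) g))"
    by (rule finite_Cauchy_product) (auto simp: K2 K3)
  also have "\<dots> = (\<Sum>k<2 * ?K. scale (t ^ k) (\<Sum>i\<le>k. dpow Lambda i f * dpow Lambda (k - i) g))"
    by (simp add: pm.scale_sum_right)
  also have "\<dots> = Phi t (star t f g)"
    by (subst K1[of "2 * ?K"]) (simp_all add: Lambda_star_coeff)
  finally show ?thesis by simp
qed

section \<open>The algebra isomorphism\<close>

lemma Phi_eq_iff: "Phi t f = Phi t g \<longleftrightarrow> f = g"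
  using bij_is_inj[OF bij_Phi] by (rule inj_eq)

lemma algebra_A_alg: "algebra complex_ring A_alg"
proof (rule algebraI)
  show "cring complex_ring" by (rule cring_from_type_algebra)
  show "cring (A_alg :: (complex, 'n xzpoly) module)"
  proof (intro cringI abelian_groupI comm_monoidI)
    show "\<exists>y\<in>carrier A_alg. y \<oplus>\<^bsub>A_alg\<^esub> x = \<zero>\<^bsub>A_alg\<^esub>" for x :: "'n xzpoly"
      by (rule bexI[of _ "- x"]) (auto simp: A_alg_def)
  qed (auto simp: A_alg_def algebra_simps)
qed (simp_all add: A_alg_def ring_of_type_algebra_def pm.scale_left_distrib
    pm.scale_right_distrib linear_op_scale[OF linear_op_times_left])

text \<open>Applying the injective map \<open>\<Phi>\<^sub>t\<close> to both sides turns each law for \<open>*\<^sub>t\<close> into the same law for the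
  usual product.\<close>

lemma algebra_B_alg: "algebra complex_ring (B_alg t :: (complex, 'n::finite xzpoly) module)"
proof (rule algebraI)
  note * = Phi_eq_iff[of t, symmetric] Phi_star Phi_one linear_op_simps[OF linear_op_Phi]
  show "cring complex_ring" by (rule cring_from_type_algebra)
  show "cring (B_alg t :: (complex, 'n xzpoly) module)"
  proof (intro cringI abelian_groupI comm_monoidI)
    show "\<exists>y\<in>carrier (B_alg t). y \<oplus>\<^bsub>B_alg t\<^esub> x = \<zero>\<^bsub>B_alg t\<^esub>" for x :: "'n xzpoly"
      by (rule bexI[of _ "- x"]) (auto simp: B_alg_def)
  qed (simp_all add: B_alg_def, simp_all add: * algebra_simps)
  show "(a \<odot>\<^bsub>B_alg t\<^esub> x) \<otimes>\<^bsub>B_alg t\<^esub> y = a \<odot>\<^bsub>B_alg t\<^esub> (x \<otimes>\<^bsub>B_alg t\<^esub> y)" for a and x y :: "'n xzpoly"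
    by (simp add: B_alg_def) (simp add: * linear_op_scale[OF linear_op_times_left])
qed (simp_all add: B_alg_def ring_of_type_algebra_def pm.scale_left_distrib
    pm.scale_right_distrib)

lemma algebra_iso_Phi: "algebra_iso complex_ring (B_alg t) A_alg (Phi t)"
  unfolding algebra_iso_def
proof (intro conjI algebra_A_alg algebra_B_alg ring_iso_memI)
  show "bij_betw (Phi t) (carrier (B_alg t)) (carrier A_alg)"
    using bij_Phi by (simp add: A_alg_def B_alg_def)
qed (auto simp: A_alg_def B_alg_def Phi_star Phi_one linear_op_simps linear_op_Phi)

section \<open>Formal deformations\<close>

text \<open>Multiplicativity of \<open>\<Psi> = \<Sum>k. t\<^sup>k \<psi>\<^sub>k\<close> is given for constant arguments.  For associativity it is
  needed where one argument is itself a power series \<open>x\<close> in \<open>t\<close>, namely a product; this follows by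
  linearity over the series in \<open>t\<close>, which amounts to regrouping a sum over triples of degrees.  The
  results are written as products in the ring of formal power series over the undeformed ring, whose
  associativity is then available.\<close>

lemma formal_hom_left:
  fixes \<psi> :: "nat \<Rightarrow> ('a :: comm_monoid_add, complex) poly_mapping \<Rightarrow> ('a \<Rightarrow>\<^sub>0 complex)"
  assumes lin: "\<And>k. linear_op (\<psi> k)"
    and hom: "\<And>k f g. (\<Sum>i\<le>k. \<psi> i (m (k - i) f g)) = (\<Sum>i\<le>k. \<psi> i f * \<psi> (k - i) g)"
  shows "Abs_fps (\<lambda>k. \<Sum>a\<le>k. \<psi> a (\<Sum>i\<le>k - a. m i (x (k - a - i)) h))
      = Abs_fps (\<lambda>k. \<Sum>a\<le>k. \<psi> a (x (k - a))) * Abs_fps (\<lambda>k. \<psi> k h)"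
proof (rule fps_ext)
  fix k
  have "(\<Sum>a\<le>k. \<psi> a (\<Sum>i\<le>k - a. m i (x (k - a - i)) h))
      = (\<Sum>a\<le>k. \<Sum>i\<le>k - a. \<psi> a (m i (x (k - a - i)) h))"
    by (simp add: linear_op_sum lin)
  also have "\<dots> = (\<Sum>j\<le>k. \<Sum>a\<le>j. \<psi> a (m (j - a) (x (k - j)) h))"
    using fps_mult_assoc_lemma[of "\<lambda>a i l. \<psi> a (m i (x l) h)" k k] by (simp add: atMost_atLeast0)
  also have "\<dots> = (\<Sum>j\<le>k. \<Sum>a\<le>j. \<psi> (j - a) (x (k - j)) * \<psi> a h)"
  proof (rule sum.cong[OF refl])
    fix j
    show "(\<Sum>a\<le>j. \<psi> a (m (j - a) (x (k - j)) h)) = (\<Sum>a\<le>j. \<psi> (j - a) (x (k - j)) * \<psi> a h)"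
      unfolding hom by (rule sum.reindex_bij_witness[of _ "\<lambda>a. j - a" "\<lambda>a. j - a"]) auto
  qed
  also have "\<dots> = (\<Sum>b\<le>k. \<Sum>a\<le>k - b. \<psi> a (x (k - b - a)) * \<psi> b h)"
    using fps_mult_assoc_lemma[of "\<lambda>b a l. \<psi> a (x l) * \<psi> b h" k k] by (simp add: atMost_atLeast0)
  also have "\<dots> = (\<Sum>b\<le>k. (\<Sum>a\<le>b. \<psi> a (x (b - a))) * \<psi> (k - b) h)"
    unfolding sum_distrib_right
    by (rule sum.reindex_bij_witness[of _ "\<lambda>b. k - b" "\<lambda>b. k - b"]) auto
  finally show "Abs_fps (\<lambda>k. \<Sum>a\<le>k. \<psi> a (\<Sum>i\<le>k - a. m i (x (k - a - i)) h)) $ k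
      = (Abs_fps (\<lambda>k. \<Sum>a\<le>k. \<psi> a (x (k - a))) * Abs_fps (\<lambda>k. \<psi> k h)) $ k"
    by (simp add: fps_mult_nth atMost_atLeast0)
qed

lemma formal_hom_right:
  fixes \<psi> :: "nat \<Rightarrow> ('a :: comm_monoid_add, complex) poly_mapping \<Rightarrow> ('a \<Rightarrow>\<^sub>0 complex)"
  assumes lin: "\<And>k. linear_op (\<psi> k)"
    and hom: "\<And>k f g. (\<Sum>i\<le>k. \<psi> i (m (k - i) f g)) = (\<Sum>i\<le>k. \<psi> i f * \<psi> (k - i) g)"
  shows "Abs_fps (\<lambda>k. \<Sum>a\<le>k. \<psi> a (\<Sum>i\<le>k - a. m i f (x (k - a - i))))
      = Abs_fps (\<lambda>k. \<psi> k f) * Abs_fps (\<lambda>k. \<Sum>a\<le>k. \<psi> a (x (k - a)))"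
proof -
  have "(\<Sum>i\<le>k. \<psi> i (m (k - i) g f)) = (\<Sum>i\<le>k. \<psi> i f * \<psi> (k - i) g)" for k f g
    unfolding hom
    by (rule sum.reindex_bij_witness[of _ "\<lambda>i. k - i" "\<lambda>i. k - i"]) (auto simp: mult.commute)
  from formal_hom_left[where m = "\<lambda>k f g. m k g f", OF lin this]
  show ?thesis by (simp add: mult.commute)
qed

text \<open>Both ways of bracketing have image \<open>\<Psi> f \<cdot> \<Psi> g \<cdot> \<Psi> h\<close> under \<open>\<Psi>\<close>, and \<open>\<Psi>\<close> is injective on power
  series because its constant term is the identity: the coefficients are recovered one after the
  other.\<close>

lemma formal_assoc:
  fixes \<psi> :: "nat \<Rightarrow> ('a :: comm_monoid_add, complex) poly_mapping \<Rightarrow> ('a \<Rightarrow>\<^sub>0 complex)"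
  assumes id: "\<psi> 0 = id" and lin: "\<And>k. linear_op (\<psi> k)"
    and hom: "\<And>k f g. (\<Sum>i\<le>k. \<psi> i (m (k - i) f g)) = (\<Sum>i\<le>k. \<psi> i f * \<psi> (k - i) g)"
  shows "(\<Sum>i\<le>k. m i (m (k - i) f g) h) = (\<Sum>i\<le>k. m i f (m (k - i) g h))"
proof -
  define L R where "L k = (\<Sum>i\<le>k. m i (m (k - i) f g) h)"
    and "R k = (\<Sum>i\<le>k. m i f (m (k - i) g h))" for k
  let ?\<Psi> = "\<lambda>f. Abs_fps (\<lambda>k. \<psi> k f)"
  have fps: "Abs_fps (\<lambda>k. \<Sum>a\<le>k. \<psi> a (m (k - a) f g)) = ?\<Psi> f * ?\<Psi> g" for f g
    by (rule fps_ext) (simp add: hom fps_mult_nth flip: atMost_atLeast0)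
  have "Abs_fps (\<lambda>k. \<Sum>a\<le>k. \<psi> a (L (k - a))) = ?\<Psi> f * ?\<Psi> g * ?\<Psi> h"
    using formal_hom_left[where x = "\<lambda>l. m l f g" and h = h, OF lin hom] by (simp only: L_def fps)
  moreover have "Abs_fps (\<lambda>k. \<Sum>a\<le>k. \<psi> a (R (k - a))) = ?\<Psi> f * (?\<Psi> g * ?\<Psi> h)"
    using formal_hom_right[where x = "\<lambda>l. m l g h" and f = f, OF lin hom] by (simp only: R_def fps)
  ultimately have "Abs_fps (\<lambda>k. \<Sum>a\<le>k. \<psi> a (L (k - a))) = Abs_fps (\<lambda>k. \<Sum>a\<le>k. \<psi> a (R (k - a)))"
    by (simp only: mult.assoc)
  then have eq: "(\<Sum>a\<le>k. \<psi> a (L (k - a))) = (\<Sum>a\<le>k. \<psi> a (R (k - a)))" for k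
    by (simp add: fps_eq_iff)
  have "L k = R k"
  proof (induction k rule: less_induct)
    case (less k)
    have split: "(\<Sum>a\<le>k. \<psi> a (y (k - a))) = y k + (\<Sum>a\<in>{..k} - {0}. \<psi> a (y (k - a)))"
      for y :: "nat \<Rightarrow> ('a \<Rightarrow>\<^sub>0 complex)"
      using sum.remove[of "{..k}" 0 "\<lambda>a. \<psi> a (y (k - a))"] by (simp add: id)
    have "(\<Sum>a\<in>{..k} - {0}. \<psi> a (L (k - a))) = (\<Sum>a\<in>{..k} - {0}. \<psi> a (R (k - a)))"
      by (intro sum.cong refl) (use less in auto)
    with eq[of k] show ?case by (simp add: split)
  qed
  then show ?thesis by (simp add: L_def R_def)
qed

lemma trivial_deformation_star:
  "trivial_deformation ((*) :: 'n::finite xzpoly \<Rightarrow> _) star"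
  unfolding trivial_deformation_def
proof (intro exI conjI)
  show "expansion star (star_coeff :: nat \<Rightarrow> 'n xzpoly \<Rightarrow> _)"
    unfolding expansion_def
  proof (intro allI conjI)
    fix f g :: "'n xzpoly" and t
    obtain N where N: "\<And>k. N \<le> k \<Longrightarrow> star_coeff k f g = 0"
      using star_coeff_eventually[of f g] unfolding eventually_sequentially by blast
    have S: "star t f g = (\<Sum>k<N. scale (t ^ k) (star_coeff k f g))"
      by (rule star_finite_sum) (rule N)
    have sub: "{k. star_coeff k f g \<noteq> 0} \<subseteq> {..<N}" using N linorder_not_less by blast
    then show "finite {k. star_coeff k f g \<noteq> 0}" by (rule finite_subset) simp
    show "star t f g = (\<Sum>k | star_coeff k f g \<noteq> 0. scale (t ^ k) (star_coeff k f g))"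
      unfolding S
      by (rule sum.mono_neutral_right) (use sub in auto)
  qed
  have id0: "dpow Lambda 0 = (id :: 'n xzpoly \<Rightarrow> _)" by (simp add: fun_eq_iff)
  note lin = linear_op_dpow[OF linear_op_Lambda]
  show "formally_trivial (*) (star_coeff :: nat \<Rightarrow> 'n xzpoly \<Rightarrow> _)"
    unfolding formally_trivial_def using id0 lin Lambda_star_coeff by blast
  show "formal_deformation (*) (star_coeff :: nat \<Rightarrow> 'n xzpoly \<Rightarrow> _)"
    unfolding formal_deformation_def
  proof (intro conjI allI)
    show "star_coeff 0 = ((*) :: 'n xzpoly \<Rightarrow> _)" by (simp add: fun_eq_iff star_coeff_def mu_tensor)
    note * = linear_op_compose[OF linear_op_dpow[OF linear_op_uminus[OF linear_op_Omega]] linear_op_mu]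
    show "linear_op (star_coeff k f)" for k and f :: "'n xzpoly"
      unfolding star_coeff_def by (rule linear_op_compose[OF linear_op_tensor_right *])
    show "linear_op (\<lambda>f. star_coeff k f g)" for k and g :: "'n xzpoly"
      unfolding star_coeff_def by (rule linear_op_compose[OF linear_op_tensor_left *])
    show "(\<Sum>i\<le>k. star_coeff i (star_coeff (k - i) f g) h)
        = (\<Sum>i\<le>k. star_coeff i f (star_coeff (k - i) g h))" for k and f g h :: "'n xzpoly"
      by (rule formal_assoc[OF id0 lin Lambda_star_coeff])
  qed
qed

theorem corollary2p2:
  shows "(\<forall>t::complex. algebra_iso complex_ring (B_alg t) (A_alg :: (complex, 'n::finite xzpoly) module) (Phi t)) \<and>
    trivial_deformation (\<lambda>f g :: 'n xzpoly. f \<otimes>\<^bsub>A_alg\<^esub> g) (\<lambda>t f g. f \<otimes>\<^bsub>B_alg t\<^esub> g)"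
  using algebra_iso_Phi trivial_deformation_star by (auto simp: A_alg_def B_alg_def)

end
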